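(* Let $\mathfrak{R}$ be an expansion of the real field $(\mathbb{R},+,\cdot)$ (i.e., a first-order structure on $\mathbb{R}$ whose language includes $+$ and $\cdot$). Then either $\mathbb{Z}$ is definable in $\mathfrak{R}$, or every bounded nowhere dense subset of $\mathbb{R}$ that is definable in $\mathfrak{R}$ is M-null.
   Context: "Definable" means definable with parameters in the structure $\mathfrak{R}$. For a bounded set $E\subseteq\mathbb{R}^n$ and $r>0$, let $N(E,r)$ be the number of closed balls of radius $r$ needed to cover $E$. The upper Minkowski dimension of $E$ is $\overline{\dim}_M E=\limsup_{r\downarrow 0}\log N(E,r)/\log(1/r)$, with the convention $\log 0:=-\infty$. A bounded set $E$ is called M-null if $\overline{\dim}_M E\le 0$. *)

theory Defs
  imports "HOL-Analysis.Analysis" "HOL-Library.Liminf_Limsup"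
begin

(* First-order logic over a language with function symbols 'f and relation symbols 'p.
   Symbols are applied to argument lists; a structure interprets each symbol on lists
   of reals (an n-ary symbol simply ignores lists of other lengths). *)

datatype 'f trm = Var nat | Fn 'f "'f trm list"

datatype ('f, 'p) fm =
    FF
  | Eq "'f trm" "'f trm"
  | Rel 'p "'f trm list"
  | Neg "('f, 'p) fm"
  | Conj "('f, 'p) fm" "('f, 'p) fm"
  | Ex nat "('f, 'p) fm"

record ('f, 'p) rstruct =
  funs :: "'f \<Rightarrow> real list \<Rightarrow> real"
  rels :: "'p \<Rightarrow> real list \<Rightarrow> bool"

fun eval_trm :: "('f, 'p) rstruct \<Rightarrow> (nat \<Rightarrow> real) \<Rightarrow> 'f trm \<Rightarrow> real" where
  "eval_trm M e (Var n) = e n"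
| "eval_trm M e (Fn f ts) = funs M f (map (eval_trm M e) ts)"

fun sat :: "('f, 'p) rstruct \<Rightarrow> (nat \<Rightarrow> real) \<Rightarrow> ('f, 'p) fm \<Rightarrow> bool" where
  "sat M e FF = False"
| "sat M e (Eq s t) = (eval_trm M e s = eval_trm M e t)"
| "sat M e (Rel p ts) = rels M p (map (eval_trm M e) ts)"
| "sat M e (Neg \<phi>) = (\<not> sat M e \<phi>)"
| "sat M e (Conj \<phi> \<psi>) = (sat M e \<phi> \<and> sat M e \<psi>)"
| "sat M e (Ex n \<phi>) = (\<exists>x. sat M (e(n := x)) \<phi>)"

definition expands_real_field :: "('f, 'p) rstruct \<Rightarrow> bool" where
  "expands_real_field M \<longleftrightarrow>
     (\<exists>p. \<forall>x y. funs M p [x, y] = x + y) \<and> (\<exists>m. \<forall>x y. funs M m [x, y] = x * y)"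

(* A \<subseteq> \<real> is definable with parameters: variable 0 is the free variable,
   all other variables are assigned parameter values by e *)
definition definable1 :: "('f, 'p) rstruct \<Rightarrow> real set \<Rightarrow> bool" where
  "definable1 M A \<longleftrightarrow> (\<exists>\<phi> e. A = {x. sat M (e(0 := x)) \<phi>})"

definition cover_num :: "real set \<Rightarrow> real \<Rightarrow> nat" where
  "cover_num E r = (LEAST k. \<exists>C. finite C \<and> card C = k \<and> E \<subseteq> (\<Union>c\<in>C. cball c r))"

(* upper Minkowski dimension, with log 0 = -\<infinity> *)
definition upper_minkowski_dim :: "real set \<Rightarrow> ereal" where
  "upper_minkowski_dim E =
     Limsup (at_right 0)
       (\<lambda>r. if cover_num E r = 0 then - \<infinity>
            else ereal (ln (real (cover_num E r)) / ln (1 / r)))"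

definition M_null :: "real set \<Rightarrow> bool" where
  "M_null E \<longleftrightarrow> bounded E \<and> upper_minkowski_dim E \<le> 0"

definition nowhere_dense :: "real set \<Rightarrow> bool" where
  "nowhere_dense A \<longleftrightarrow> interior (closure A) = {}"

end

theory Submission
  imports Defs
begin

text \<open>
  Let \<open>A\<close> be bounded, nowhere dense, definable and not M-null. The right ends of the complementary
  gaps of \<open>A\<close> are dense in \<open>A\<close>, and only finitely many of them end a gap of length at least \<open>1/T\<close>;
  thus they form a set \<open>X\<close> of points that appear in time (a gap of length \<open>l\<close> at time \<open>1/l\<close>), finitely
  many up to each time. If the ratios \<open>(a - b) / (c - d)\<close> of differences of \<open>X\<close> avoid a neighbourhood
  of some \<open>x\<close>, then \<open>(a, b) \<mapsto> a + x b\<close> is injective on \<open>X \<times> X\<close> and separates points well, so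
  \<open>X + x X\<close> has almost twice the dimension of \<open>X\<close>. As a bounded set of reals has dimension at most 1,
  after finitely many such steps the ratios are dense in \<open>(0, 1)\<close>. The ratios again appear in time,
  finitely many up to each time.

  From such timed points dense in \<open>(0, 1)\<close> one defines the integers with two real parameters.
  The first, \<open>c\<close>, is chosen such that the times \<open>t\<^sub>0 < t\<^sub>1 < \<dots>\<close> at which a point closer to \<open>c\<close> from
  the left appears are as sparse as we like. The second, \<open>a\<close>, is found by nested intervals: if
  \<open>y\<^sub>k < a < z\<^sub>k\<close> are the neighbours of \<open>a\<close> at time \<open>t\<^sub>k\<close>, then sparseness leaves enough room to
  arrange that \<open>(z\<^sub>k - y\<^sub>k) / (a - y\<^sub>k)\<close> is within \<open>1 / (k + 2)\<close> of \<open>k + 2\<close>. The integers are the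
  asymptotic differences of these ratios.
\<close>

section \<open>Definable predicates\<close>

fun rename_trm :: "(nat \<Rightarrow> nat) \<Rightarrow> 'f trm \<Rightarrow> 'f trm" where
  "rename_trm g (Var n) = Var (g n)"
| "rename_trm g (Fn f ts) = Fn f (map (rename_trm g) ts)"

fun rename_fm :: "(nat \<Rightarrow> nat) \<Rightarrow> ('f, 'p) fm \<Rightarrow> ('f, 'p) fm" where
  "rename_fm g FF = FF"
| "rename_fm g (Eq s t) = Eq (rename_trm g s) (rename_trm g t)"
| "rename_fm g (Rel p ts) = Rel p (map (rename_trm g) ts)"
| "rename_fm g (Neg \<phi>) = Neg (rename_fm g \<phi>)"
| "rename_fm g (Conj \<phi> \<psi>) = Conj (rename_fm g \<phi>) (rename_fm g \<psi>)"
| "rename_fm g (Ex n \<phi>) = Ex (g n) (rename_fm g \<phi>)"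

lemma eval_rename_trm: "eval_trm M e (rename_trm g t) = eval_trm M (\<lambda>n. e (g n)) t"
proof (induction t)
  case (Fn f ts)
  then show ?case by (auto intro!: arg_cong[where f = "funs M f"])
qed simp

text \<open>Injectivity of \<open>g\<close> ensures that updating the renamed bound variable
  \<open>g n\<close> changes no other renamed variable.\<close>

lemma sat_rename_fm:
  assumes "inj g"
  shows "sat M e (rename_fm g \<phi>) = sat M (\<lambda>n. e (g n)) \<phi>"
proof (induction \<phi> arbitrary: e)
  case (Rel p ts)
  have "map (eval_trm M e) (map (rename_trm g) ts) = map (eval_trm M (\<lambda>n. e (g n))) ts"
    by (simp add: eval_rename_trm)
  then show ?case by (metis rename_fm.simps(3) sat.simps(3))
next
  case (Ex n \<phi>)
  have "(\<lambda>m. (e(g n := x)) (g m)) = (\<lambda>m. e (g m))(n := x)" for x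
    using assms by (auto simp: fun_eq_iff inj_eq)
  then show ?case by (simp only: rename_fm.simps sat.simps Ex)
qed (simp_all add: eval_rename_trm)

text \<open>Even variables carry the free variables of a predicate, odd variables its parameters.
  This way parameters of several formulas can be merged by renaming.\<close>

definition interleave :: "(nat \<Rightarrow> 'a) \<Rightarrow> (nat \<Rightarrow> 'a) \<Rightarrow> nat \<Rightarrow> 'a" where
  "interleave e p n = (if even n then e (n div 2) else p (n div 2))"

definition definable_fun :: "('f, 'p) rstruct \<Rightarrow> ((nat \<Rightarrow> real) \<Rightarrow> real) \<Rightarrow> bool" where
  "definable_fun M f \<longleftrightarrow> (\<exists>t p. \<forall>e. f e = eval_trm M (interleave e p) t)"

definition definable_pred :: "('f, 'p) rstruct \<Rightarrow> ((nat \<Rightarrow> real) \<Rightarrow> bool) \<Rightarrow> bool" where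
  "definable_pred M Q \<longleftrightarrow> (\<exists>\<phi> p. \<forall>e. Q e = sat M (interleave e p) \<phi>)"

text \<open>Free variables stay put. The \<open>k\<close>-th parameter moves to slot
  \<open>2 * k\<close> here and to slot \<open>2 * k + 1\<close> under \<open>param_right\<close>,
  where \<open>interleave p q\<close> holds \<open>p\<close> and \<open>q\<close>.\<close>

definition param_left :: "nat \<Rightarrow> nat" where
  "param_left n = (if even n then n else 4 * (n div 2) + 1)"

definition param_right :: "nat \<Rightarrow> nat" where
  "param_right n = (if even n then n else 4 * (n div 2) + 3)"

lemma inj_param_left: "inj param_left"
proof (rule injI)
  fix m n assume "param_left m = param_left n"
  then show "m = n"
    by (cases "even m"; cases "even n") (auto simp: param_left_def elim!: oddE evenE; presburger)+
qed

lemma inj_param_right: "inj param_right"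
proof (rule injI)
  fix m n assume "param_right m = param_right n"
  then show "m = n"
    by (cases "even m"; cases "even n") (auto simp: param_right_def elim!: oddE evenE; presburger)+
qed

lemma interleave_param_left: "(\<lambda>n. interleave e (interleave p q) (param_left n)) = interleave e p"
proof
  fix n :: nat
  show "interleave e (interleave p q) (param_left n) = interleave e p n"
    by (cases "even n") (auto simp: interleave_def param_left_def elim!: oddE)
qed

lemma interleave_param_right: "(\<lambda>n. interleave e (interleave p q) (param_right n)) = interleave e q"
proof
  fix n :: nat
  have "odd n \<Longrightarrow> (4 * (n div 2) + 3) div 2 = 2 * (n div 2) + 1" by presburger
  moreover have "(2 * (n div 2) + 1) div 2 = n div 2" by presburger
  ultimately show "interleave e (interleave p q) (param_right n) = interleave e q n"
    by (simp add: interleave_def param_right_def)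
qed

lemma definable_fun_common:
  assumes "definable_fun M f" "definable_fun M g"
  obtains s t p where "\<And>e. f e = eval_trm M (interleave e p) s" "\<And>e. g e = eval_trm M (interleave e p) t"
proof -
  obtain s p where s: "\<And>e. f e = eval_trm M (interleave e p) s"
    using assms(1) unfolding definable_fun_def by blast
  obtain t q where t: "\<And>e. g e = eval_trm M (interleave e q) t"
    using assms(2) unfolding definable_fun_def by blast
  show thesis
    by (rule that[of "interleave p q" "rename_trm param_left s" "rename_trm param_right t"])
      (simp_all only: eval_rename_trm interleave_param_left interleave_param_right s t)
qed

lemma definable_pred_conj:
  assumes "definable_pred M P" "definable_pred M Q"
  shows "definable_pred M (\<lambda>e. P e \<and> Q e)"
proof -
  obtain \<phi> p where 1: "\<And>e. P e = sat M (interleave e p) \<phi>"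
    using assms(1) unfolding definable_pred_def by blast
  obtain \<psi> q where 2: "\<And>e. Q e = sat M (interleave e q) \<psi>"
    using assms(2) unfolding definable_pred_def by blast
  show ?thesis unfolding definable_pred_def
    by (rule exI[of _ "Conj (rename_fm param_left \<phi>) (rename_fm param_right \<psi>)"],
        rule exI[of _ "interleave p q"])
      (simp only: sat.simps sat_rename_fm inj_param_left inj_param_right
        interleave_param_left interleave_param_right 1 2 simp_thms)
qed

lemma definable_pred_not:
  assumes "definable_pred M P"
  shows "definable_pred M (\<lambda>e. \<not> P e)"
proof -
  obtain \<phi> p where "\<And>e. P e = sat M (interleave e p) \<phi>"
    using assms unfolding definable_pred_def by blast
  then have "\<forall>e. (\<not> P e) = sat M (interleave e p) (Neg \<phi>)" by simp
  then show ?thesis unfolding definable_pred_def by blast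
qed

lemma definable_pred_disj:
  assumes "definable_pred M P" "definable_pred M Q"
  shows "definable_pred M (\<lambda>e. P e \<or> Q e)"
  using definable_pred_not[OF definable_pred_conj[OF assms[THEN definable_pred_not]]] by simp

lemma definable_pred_imp:
  assumes "definable_pred M P" "definable_pred M Q"
  shows "definable_pred M (\<lambda>e. P e \<longrightarrow> Q e)"
  using definable_pred_disj[OF definable_pred_not[OF assms(1)] assms(2)] by simp

text \<open>Quantifiers in de Bruijn style: below the binder, variable 0 is the bound one.\<close>

lemma definable_pred_ex:
  assumes "definable_pred M (\<lambda>e. Q (e 0) (\<lambda>n. e (Suc n)))"
  shows "definable_pred M (\<lambda>e. \<exists>x. Q x e)"
proof -
  obtain \<phi> p where \<phi>: "\<And>e. Q (e 0) (\<lambda>n. e (Suc n)) = sat M (interleave e p) \<phi>"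
    using assms unfolding definable_pred_def by blast
  \<comment> \<open>The bound variable 0 goes to 1, the other free variables move down by one place,
    and the parameters move up by one place to vacate 1. Outside the quantifier the vacated slot
    carries the dummy value 0 of \<open>case_nat 0 p\<close>.\<close>
  define g :: "nat \<Rightarrow> nat" where "g n = (if n = 0 then 1 else if even n then n - 2 else n + 2)" for n
  have "inj g"
  proof (rule injI)
    fix m n assume "g m = g n"
    then show "m = n"
      by (cases "even m"; cases "even n") (auto simp: g_def split: if_splits elim!: oddE evenE; presburger)+
  qed
  have *: "(\<lambda>n. ((interleave e (case_nat 0 p))(1 := x)) (g n)) = interleave (case_nat x e) p" for e x
  proof
    fix n :: nat
    have "n = 0 \<or> (\<exists>m. n = 2 * m + 2) \<or> (\<exists>m. n = 2 * m + 1)" by presburger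
    then consider "n = 0" | m where "n = 2 * m + 2" | m where "n = 2 * m + 1" by blast
    then show "((interleave e (case_nat 0 p))(1 := x)) (g n) = interleave (case_nat x e) p n"
      by cases (auto simp: g_def interleave_def)
  qed
  have "Q x e = sat M (interleave (case_nat x e) p) \<phi>" for x e
    using \<phi>[of "case_nat x e"] by simp
  then have "(\<exists>x. Q x e) = sat M (interleave e (case_nat 0 p)) (Ex 1 (rename_fm g \<phi>))" for e
    by (simp only: sat.simps sat_rename_fm[OF \<open>inj g\<close>] *)
  then show ?thesis unfolding definable_pred_def by blast
qed

lemma definable_pred_all:
  assumes "definable_pred M (\<lambda>e. Q (e 0) (\<lambda>n. e (Suc n)))"
  shows "definable_pred M (\<lambda>e. \<forall>x. Q x e)"
  using definable_pred_not[OF definable_pred_ex[OF definable_pred_not[OF assms]]] by simp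

lemma definable_fun_var: "definable_fun M (\<lambda>e. e i)"
  unfolding definable_fun_def by (rule exI[of _ "Var (2 * i)"]) (simp add: interleave_def)

lemma definable_fun_const: "definable_fun M (\<lambda>e. c)"
  unfolding definable_fun_def
  by (rule exI[of _ "Var 1"], rule exI[of _ "\<lambda>_. c"]) (simp add: interleave_def)

lemma definable_fun_shift:
  assumes "definable_fun M f"
  shows "definable_fun M (\<lambda>e. f (\<lambda>n. e (Suc n)))"
proof -
  obtain t p where t: "\<And>e. f e = eval_trm M (interleave e p) t"
    using assms unfolding definable_fun_def by blast
  define g :: "nat \<Rightarrow> nat" where "g n = (if even n then n + 2 else n)" for n
  have "(\<lambda>n. interleave e p (g n)) = interleave (\<lambda>n. e (Suc n)) p" for e
    by (auto simp: fun_eq_iff g_def interleave_def)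
  then show ?thesis unfolding definable_fun_def t
    by (metis eval_rename_trm)
qed

lemma definable_pred_eq:
  assumes "definable_fun M f" "definable_fun M g"
  shows "definable_pred M (\<lambda>e. f e = g e)"
proof -
  obtain s t p where "\<And>e. f e = eval_trm M (interleave e p) s" "\<And>e. g e = eval_trm M (interleave e p) t"
    using definable_fun_common[OF assms] by metis
  then have "\<forall>e. (f e = g e) = sat M (interleave e p) (Eq s t)" by simp
  then show ?thesis unfolding definable_pred_def by blast
qed

lemma definable_pred_mem:
  assumes "definable1 M A"
  shows "definable_pred M (\<lambda>e. e i \<in> A)"
proof -
  obtain \<phi> p where A: "A = {x. sat M (p(0 := x)) \<phi>}"
    using assms unfolding definable1_def by blast
  \<comment> \<open>All variables of \<open>\<phi>\<close> become parameters. The former free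
    variable 0 lands on variable 1, which the quantifier binds and the equation sets to
    \<open>e i\<close>.\<close>
  define g :: "nat \<Rightarrow> nat" where "g n = 2 * n + 1" for n
  have "inj g" by (auto simp: inj_def g_def)
  have *: "(\<lambda>n. ((interleave e p)(1 := x)) (g n)) = p(0 := x)" for e x
    by (auto simp: fun_eq_iff g_def interleave_def)
  have "(e i \<in> A) = sat M (interleave e p) (Ex 1 (Conj (Eq (Var 1) (Var (2 * i))) (rename_fm g \<phi>)))" for e
    by (simp only: sat.simps sat_rename_fm[OF \<open>inj g\<close>] *) (simp add: A interleave_def)
  then show ?thesis unfolding definable_pred_def by blast
qed

lemma definable1_of_pred:
  assumes "definable_pred M (\<lambda>e. e 0 \<in> A)"
  shows "definable1 M A"
proof -
  obtain \<phi> p where \<phi>: "\<And>e. (e 0 \<in> A) = sat M (interleave e p) \<phi>"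
    using assms unfolding definable_pred_def by blast
  have "(interleave (\<lambda>_. 0) p)(0 := x) = interleave ((\<lambda>_. 0)(0 := x)) p" for x
    by (auto simp: fun_eq_iff interleave_def)
  then have "A = {x. sat M ((interleave (\<lambda>_. 0) p)(0 := x)) \<phi>}"
    using \<phi>[of "(\<lambda>_. 0)(0 := _)"] by auto
  then show ?thesis unfolding definable1_def by blast
qed

section \<open>Definability with the field operations and the order\<close>

locale real_field_expansion =
  fixes M :: "('f, 'p) rstruct"
  assumes expands: "expands_real_field M"
begin

lemma definable_fun_add:
  assumes "definable_fun M f" "definable_fun M g"
  shows "definable_fun M (\<lambda>e. f e + g e)"
proof -
  obtain a where "\<And>x y. funs M a [x, y] = x + y" using expands unfolding expands_real_field_def by blast
  moreover obtain s t p where "\<And>e. f e = eval_trm M (interleave e p) s" "\<And>e. g e = eval_trm M (interleave e p) t"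
    using definable_fun_common[OF assms] by metis
  ultimately have "\<forall>e. f e + g e = eval_trm M (interleave e p) (Fn a [s, t])" by simp
  then show ?thesis unfolding definable_fun_def by blast
qed

lemma definable_fun_mult:
  assumes "definable_fun M f" "definable_fun M g"
  shows "definable_fun M (\<lambda>e. f e * g e)"
proof -
  obtain a where "\<And>x y. funs M a [x, y] = x * y" using expands unfolding expands_real_field_def by blast
  moreover obtain s t p where "\<And>e. f e = eval_trm M (interleave e p) s" "\<And>e. g e = eval_trm M (interleave e p) t"
    using definable_fun_common[OF assms] by metis
  ultimately have "\<forall>e. f e * g e = eval_trm M (interleave e p) (Fn a [s, t])" by simp
  then show ?thesis unfolding definable_fun_def by blast
qed

lemma definable_fun_diff:
  assumes "definable_fun M f" "definable_fun M g"
  shows "definable_fun M (\<lambda>e. f e - g e)"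
  using definable_fun_add[OF assms(1) definable_fun_mult[OF definable_fun_const[of M "-1"] assms(2)]] by simp

text \<open>The nonnegative reals are the squares, so the field operations already define the
  order.\<close>

lemma definable_pred_le:
  assumes "definable_fun M f" "definable_fun M g"
  shows "definable_pred M (\<lambda>e. f e \<le> g e)"
proof -
  have "(x \<le> y) = (\<exists>z. y = x + z * z)" for x y :: real
    using real_sqrt_mult_self[of "y - x"] by (auto intro!: exI[of _ "sqrt (y - x)"])
  then show ?thesis
    by (simp only:) (intro definable_pred_ex definable_pred_eq definable_fun_add definable_fun_mult
        definable_fun_var definable_fun_shift assms)
qed

lemma definable_pred_less:
  assumes "definable_fun M f" "definable_fun M g"
  shows "definable_pred M (\<lambda>e. f e < g e)"
  using definable_pred_not[OF definable_pred_le[OF assms(2,1)]] by (simp add: not_le)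

text \<open>These rules prove definability by following the syntax. The predicates to be shown
  definable below therefore avoid division, absolute values and bounded quantifiers.\<close>

lemmas definable_intros =
  definable_pred_conj definable_pred_not definable_pred_disj definable_pred_imp
  definable_pred_ex definable_pred_all definable_pred_eq definable_pred_le definable_pred_less
  definable_fun_var definable_fun_const definable_fun_add definable_fun_mult definable_fun_diff

text \<open>All pairs of indices are included because the arguments of \<open>P\<close> sit at
  different variables under different binders.\<close>

definition definable2 :: "(real \<Rightarrow> real \<Rightarrow> bool) \<Rightarrow> bool" where
  "definable2 P \<longleftrightarrow> (\<forall>i j. definable_pred M (\<lambda>e. P (e i) (e j)))"

lemma definable2D: "definable2 P \<Longrightarrow> definable_pred M (\<lambda>e. P (e i) (e j))"
  by (simp add: definable2_def)

end

section \<open>Integers from timed dense points\<close>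

text \<open>The supremum of the left ends works: strict nesting keeps it away from every
  end.\<close>

lemma nested_open_intervals:
  fixes l u :: "nat \<Rightarrow> real"
  assumes l: "\<And>n. l n < l (Suc n)" and u: "\<And>n. u (Suc n) < u n" and lu: "\<And>n. l n < u n"
  obtains a where "\<And>n. l n < a" "\<And>n. a < u n"
proof -
  have "incseq l" "decseq u"
    using l u by (simp_all add: incseq_Suc_iff decseq_Suc_iff less_imp_le)
  then have le: "l m \<le> u n" for m n
    using lu[of "max m n"] incseqD[of l m "max m n"] decseqD[of u n "max m n"] by linarith
  then have bdd: "bdd_above (range l)" by (auto simp: bdd_above_def)
  have "l n < Sup (range l)" for n
    using l[of n] cSup_upper[OF _ bdd, of "l (Suc n)"] by auto
  moreover have "Sup (range l) < u n" for n
    using u[of n] cSup_least[of "range l" "u (Suc n)"] le by force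
  ultimately show thesis using that by blast
qed

text \<open>The window for \<open>a\<close> comes from solving the conclusion for \<open>a\<close>;
  \<open>2 \<le> N\<close> makes \<open>N - 1 / N\<close> positive, and even greater than 1, which
  keeps the window inside the gap from \<open>y\<close> to \<open>z\<close>.\<close>

lemma ratio_window:
  fixes y z a N :: real
  assumes "y < z" "2 \<le> N" "y + (z - y) / (N + 1 / N) < a" "a < y + (z - y) / (N - 1 / N)"
  shows "\<bar>(z - y) / (a - y) - N\<bar> < 1 / N"
proof -
  have "1 / N \<le> 1 / 2" "0 < 1 / N" using assms(2) by (simp_all add: frac_le)
  then have N: "0 < N - 1 / N" "0 < N + 1 / N" using assms(2) by linarith+
  have "0 < (z - y) / (N + 1 / N)" using assms(1) N by simp
  then have "0 < a - y" using assms(3) by linarith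
  moreover have "(z - y) / (N + 1 / N) < a - y" "a - y < (z - y) / (N - 1 / N)" using assms by auto
  ultimately have "(z - y) / (a - y) < N + 1 / N" "N - 1 / N < (z - y) / (a - y)"
    using N by (auto simp: pos_divide_less_eq pos_less_divide_eq mult.commute)
  then show ?thesis by auto
qed

lemma window_bounds:
  fixes y z N :: real
  assumes "y < z" "2 \<le> N"
  shows "y < y + (z - y) / (N + 1 / N)" "y + (z - y) / (N + 1 / N) < y + (z - y) / (N - 1 / N)"
    "y + (z - y) / (N - 1 / N) < z"
proof -
  have "1 / N \<le> 1 / 2" using assms(2) by (simp add: frac_le)
  then have N: "1 < N - 1 / N" "0 < 1 / N" using assms(2) by (linarith, simp)
  then show "y < y + (z - y) / (N + 1 / N)" using assms by (simp add: add_pos_pos)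
  show "y + (z - y) / (N + 1 / N) < y + (z - y) / (N - 1 / N)"
    using N assms by (simp add: divide_strict_left_mono mult_pos_pos add_pos_pos)
  have "(z - y) / (N - 1 / N) < (z - y) / 1"
    using N assms by (intro divide_strict_left_mono) auto
  then show "y + (z - y) / (N - 1 / N) < z" by simp
qed

text \<open>\<open>P t y\<close> is read as: the point \<open>y\<close> appears at time \<open>t\<close>.\<close>

locale timed_dense_points =
  fixes P :: "real \<Rightarrow> real \<Rightarrow> bool"
  assumes finite_until: "finite {(t, y). P t y \<and> t \<le> T}"
    and in_unit: "P t y \<Longrightarrow> 0 < y \<and> y < 1"
    and dense: "0 \<le> p \<Longrightarrow> p < q \<Longrightarrow> q \<le> 1 \<Longrightarrow> \<exists>t y. P t y \<and> p < y \<and> y < q"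
begin

text \<open>Because of \<open>y \<le> w\<close> instead of \<open>y < w\<close>, a later
  reappearance of the same record \<open>y\<close> does not count as a new record.\<close>

definition record_times :: "real \<Rightarrow> real set" where
  "record_times c = {s. \<exists>y. P s y \<and> y < c \<and> (\<forall>t w. P t w \<and> t < s \<longrightarrow> \<not> (y \<le> w \<and> w < c))}"

text \<open>With 0 and 1 added, every other point of the unit interval has neighbours on both sides
  at any time.\<close>

definition points_until :: "real \<Rightarrow> real set" where
  "points_until s = {y. y = 0 \<or> y = 1 \<or> (\<exists>t. t \<le> s \<and> P t y)}"

definition gap_ratios :: "real \<Rightarrow> real \<Rightarrow> real set" where
  "gap_ratios c a = {v. \<exists>s. s \<in> record_times c \<and> (\<exists>y z. y \<in> points_until s \<and> z \<in> points_until s \<and>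
     y < a \<and> a < z \<and> (\<forall>w. w \<in> points_until s \<longrightarrow> \<not> (y < w \<and> w < z)) \<and> v * (a - y) = z - y)}"

definition first_time :: "real \<Rightarrow> real \<Rightarrow> real \<Rightarrow> bool" where
  "first_time l b t \<longleftrightarrow> (\<exists>y. P t y \<and> l < y \<and> y < b) \<and> (\<forall>t' y. P t' y \<and> l < y \<and> y < b \<longrightarrow> t \<le> t')"

text \<open>Density gives one point in the interval, and only finitely many points compete with it
  for an earlier time.\<close>

lemma first_time_exists:
  assumes "0 \<le> l" "l < b" "b \<le> 1"
  shows "\<exists>t. first_time l b t"
proof -
  obtain t0 y0 where 0: "P t0 y0" "l < y0" "y0 < b" using dense assms by blast
  define X where "X = {(t, y). P t y \<and> t \<le> t0} \<inter> {(t, y). l < y \<and> y < b}"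
  have X: "finite (fst ` X)" using finite_until[of t0] by (simp add: X_def)
  have "(t0, y0) \<in> X" using 0 by (simp add: X_def)
  then have ne: "fst ` X \<noteq> {}" by blast
  define t where "t = Min (fst ` X)"
  have "t \<in> fst ` X" unfolding t_def using Min_in[OF X ne] .
  then obtain y where "P t y" "l < y" "y < b" "t \<le> t0" by (auto simp: X_def)
  moreover have "t \<le> t'" if "P t' y'" "l < y'" "y' < b" for t' y'
  proof (cases "t' \<le> t0")
    case True
    then have "(t', y') \<in> X" using that by (simp add: X_def)
    then have "t' \<in> fst ` X" by force
    then show ?thesis unfolding t_def using Min_le[OF X] by blast
  qed (use \<open>t \<le> t0\<close> in simp)
  ultimately show ?thesis unfolding first_time_def by blast
qed

lemma finite_points_until: "finite (points_until s)"
proof -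
  have "points_until s \<subseteq> {0, 1} \<union> snd ` {(t, y). P t y \<and> t \<le> s}"
    by (force simp: points_until_def)
  then show ?thesis using finite_subset finite_until by blast
qed

lemma points_until_mono: "s \<le> t \<Longrightarrow> points_until s \<subseteq> points_until t"
  by (force simp: points_until_def)

lemma points_until_unit: "y \<in> points_until s \<Longrightarrow> 0 \<le> y \<and> y \<le> 1"
  using in_unit by (force simp: points_until_def)

lemma next_point:
  assumes "y \<in> points_until s" "z \<in> points_until s" "y < z"
  obtains z' where "z' \<in> points_until s" "y < z'" "z' \<le> z" "\<And>w. w \<in> points_until s \<Longrightarrow> \<not> (y < w \<and> w < z')"
proof -
  define X where "X = {w \<in> points_until s. y < w}"
  have X: "finite X" "z \<in> X" using finite_points_until assms by (auto simp: X_def)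
  have "Min X \<in> X" using X Min_in by blast
  moreover have le: "Min X \<le> w" if "w \<in> X" for w using X that by simp
  moreover have "\<not> (y < w \<and> w < Min X)" if "w \<in> points_until s" for w
    using le[of w] that by (auto simp: X_def)
  ultimately show thesis using that[of "Min X"] X by (simp add: X_def)
qed

text \<open>Only finitely many points have appeared by any given time, so shrinking the interval that will
  contain \<open>c\<close> to the right of the current record delays the next record as much as we like.\<close>

lemma sparse_record_times:
  fixes \<Phi> :: "nat \<Rightarrow> real \<Rightarrow> real"
  obtains c t where "record_times c = range t" "\<And>k. \<Phi> k (t k) < t (Suc k)"
proof -
  \<comment> \<open>A stage consists of the current record \<open>l\<close> (0 at the start), an
    upper bound \<open>b\<close> for \<open>c\<close>, and the first time \<open>t\<close> at which
    a point between them appears. In \<open>R\<close>, such a point becomes the next record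
    \<open>l'\<close>, and \<open>b'\<close> is so close to it that nothing lies between them until
    time \<open>\<Phi> n t\<close>.\<close>
  define I where "I n x = (case x of (l, b, t) \<Rightarrow> 0 \<le> l \<and> l < b \<and> b \<le> 1 \<and> first_time l b t \<and>
    (n = 0 \<longrightarrow> l = 0))" for n :: nat and x :: "real \<times> real \<times> real"
  define R where "R n x x' = (case (x, x') of ((l, b, t), (l', b', t')) \<Rightarrow> P t l' \<and> l < l' \<and> l' < b' \<and> b' < b \<and>
    (\<forall>s y. P s y \<and> s \<le> \<Phi> n t \<longrightarrow> \<not> (l' < y \<and> y < b')))"
    for n and x x' :: "real \<times> real \<times> real"
  obtain t0 where "first_time 0 1 t0" using first_time_exists[of 0 1] by auto
  then have start: "\<exists>x. I 0 x" by (intro exI[of _ "(0, 1, t0)"]) (simp add: I_def)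
  have step: "\<exists>x'. I (Suc n) x' \<and> R n x x'" if "I n x" for n x
  proof -
    obtain l b t where x: "x = (l, b, t)" by (cases x) auto
    have lb: "0 \<le> l" "l < b" "b \<le> 1" "first_time l b t" using that by (auto simp: I_def x)
    then obtain l' where l': "P t l'" "l < l'" "l' < b" by (auto simp: first_time_def)
    define Y where "Y = insert b {y \<in> points_until (\<Phi> n t). l' < y}"
    have Y: "finite Y" "Y \<noteq> {}" using finite_points_until by (auto simp: Y_def)
    have "Min Y \<in> Y" using Y by simp
    then have Y1: "l' < Min Y" "Min Y \<le> b" using l' Y by (auto simp: Y_def)
    define b' where "b' = (l' + Min Y) / 2"
    have b': "l' < b'" "b' < b" "b' < Min Y" using Y1 by (auto simp: b'_def)
    have "\<not> (l' < y \<and> y < b')" if "P s y" "s \<le> \<Phi> n t" for s y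
    proof
      assume "l' < y \<and> y < b'"
      then have "y \<in> Y" using that by (auto simp: Y_def points_until_def)
      then show False using Min_le[of Y y] Y b' \<open>l' < y \<and> y < b'\<close> by linarith
    qed
    moreover obtain t' where "first_time l' b' t'" using first_time_exists[of l' b'] lb l' b' by force
    ultimately have "I (Suc n) (l', b', t') \<and> R n x (l', b', t')"
      using lb l' b' by (auto simp: I_def R_def x)
    then show ?thesis by blast
  qed
  obtain f where f: "\<And>n. I n (f n)" "\<And>n. R n (f n) (f (Suc n))"
    using dependent_nat_choice[of I R, OF start step] by blast
  define l b t where "l n = fst (f n)" and "b n = fst (snd (f n))" and "t n = snd (snd (f n))" for n
  have f_eq: "f n = (l n, b n, t n)" for n by (simp add: l_def b_def t_def)
  have ft: "first_time (l n) (b n) (t n)" and l0: "l 0 = 0" and lb: "l n < b n" for n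
    using f(1) by (auto simp: I_def f_eq)
  have Pl: "P (t n) (l (Suc n))" and l: "l n < l (Suc n)" and b: "b (Suc n) < b n"
    and R: "P s y \<Longrightarrow> s \<le> \<Phi> n (t n) \<Longrightarrow> \<not> (l (Suc n) < y \<and> y < b (Suc n))" for n s y
    using f(2)[of n] by (auto simp: R_def f_eq)
  obtain c where c: "\<And>n. l n < c" "\<And>n. c < b n"
    using nested_open_intervals[of l b] l b lb by blast
  have early: "t n \<le> s" if "P s y" "l n < y" "y < b n" for n s y
    using ft[of n] that by (auto simp: first_time_def)
  have "\<Phi> k (t k) < t (Suc k)" for k
    using ft[of "Suc k"] R[of "t (Suc k)" _ k] by (force simp: first_time_def)
  moreover have "record_times c = range t"
  proof (intro equalityI subsetI)
    fix s assume "s \<in> range t"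
    then obtain k where s: "s = t k" by blast
    have "\<not> (l (Suc k) \<le> w \<and> w < c)" if "P t' w" "t' < t k" for t' w
      using early[of t' w k] that l[of k] c(2)[of k] by force
    then show "s \<in> record_times c" unfolding record_times_def using s Pl c by blast
  next
    fix s assume "s \<in> record_times c"
    then obtain y where y: "P s y" "y < c" and rec: "\<And>t w. P t w \<Longrightarrow> t < s \<Longrightarrow> \<not> (y \<le> w \<and> w < c)"
      unfolding record_times_def by blast
    \<comment> \<open>A point \<open>y\<close> above all \<open>l n\<close> would lie in every
      interval, so infinitely many distinct records would have appeared by time
      \<open>s\<close>.\<close>
    have "\<exists>n. y \<le> l n"
    proof (rule ccontr)
      assume no: "\<nexists>n. y \<le> l n"
      have "P (t n) (l (Suc n)) \<and> t n \<le> s" for n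
        using Pl[of n] early[of s y n] y no c(2)[of n] by (force simp: not_le)
      then have "range (\<lambda>n. l (Suc n)) \<subseteq> points_until s" by (auto simp: points_until_def)
      then have "finite (range (\<lambda>n. l (Suc n)))" using finite_points_until finite_subset by blast
      moreover have "inj (\<lambda>n. l (Suc n))"
        using l by (intro strict_mono_imp_inj_on) (simp add: strict_mono_Suc_iff)
      ultimately show False using finite_imageD[of _ UNIV] by blast
    qed
    \<comment> \<open>At the first such stage \<open>n = Suc k\<close>, \<open>y\<close> lies
      between \<open>l k\<close> and \<open>b k\<close>, which gives \<open>t k \<le> s\<close>. The
      record \<open>l n\<close> appears at time \<open>t k\<close> between \<open>y\<close> and
      \<open>c\<close>, so \<open>t k < s\<close> would contradict that \<open>s\<close> is a record
      time.\<close>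
    then obtain n where n: "y \<le> l n" "\<And>m. m < n \<Longrightarrow> \<not> y \<le> l m"
      using exists_least_iff[of "\<lambda>n. y \<le> l n"] by blast
    have "n \<noteq> 0" using n(1) l0 in_unit[OF y(1)] by (intro notI) simp
    then obtain k where k: "n = Suc k" by (cases n) auto
    have "l k < y" using n(2)[of k] k by simp
    then have "t k \<le> s" using early[of s y k] y c(2)[of k] by simp
    moreover have "\<not> t k < s" using rec[OF Pl[of k]] n(1) k c(1) by blast
    ultimately show "s \<in> range t" by force
  qed
  ultimately show thesis using that by blast
qed

text \<open>Density serves each pair \<open>y < z\<close> separately; the finitely many pairs until
  time \<open>s\<close> allow one common \<open>T\<close>. Two points are needed because the next
  gap is to lie between them.\<close>

lemma two_points_in_window:
  fixes N :: real
  assumes "2 \<le> N"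
  obtains T where "\<And>y z. y \<in> points_until s \<Longrightarrow> z \<in> points_until s \<Longrightarrow> y < z \<Longrightarrow>
    \<exists>y' z'. y' \<in> points_until T \<and> z' \<in> points_until T \<and>
      y + (z - y) / (N + 1 / N) < y' \<and> y' < z' \<and> z' < y + (z - y) / (N - 1 / N)"
proof -
  define W where "W T y z \<longleftrightarrow> (\<exists>y' z'. y' \<in> points_until T \<and> z' \<in> points_until T \<and>
      y + (z - y) / (N + 1 / N) < y' \<and> y' < z' \<and> z' < y + (z - y) / (N - 1 / N))" for T y z
  have "\<exists>T. W T y z" if "y \<in> points_until s" "z \<in> points_until s" "y < z" for y z
  proof -
    note w = window_bounds[OF \<open>y < z\<close> assms]
    have yz: "0 \<le> y" "z \<le> 1" using points_until_unit that by auto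
    obtain t1 y1 where 1: "P t1 y1" "y + (z - y) / (N + 1 / N) < y1" "y1 < y + (z - y) / (N - 1 / N)"
      using dense[of "y + (z - y) / (N + 1 / N)" "y + (z - y) / (N - 1 / N)"] w yz by force
    obtain t2 y2 where 2: "P t2 y2" "y1 < y2" "y2 < y + (z - y) / (N - 1 / N)"
      using dense[of y1 "y + (z - y) / (N - 1 / N)"] w yz 1 by force
    have "y1 \<in> points_until (max t1 t2)" "y2 \<in> points_until (max t1 t2)"
      using 1 2 by (auto simp: points_until_def)
    then show ?thesis unfolding W_def using 1 2 by blast
  qed
  then obtain \<tau> where \<tau>: "\<And>y z. y \<in> points_until s \<Longrightarrow> z \<in> points_until s \<Longrightarrow> y < z \<Longrightarrow> W (\<tau> y z) y z"
    by metis
  define X where "X = (\<lambda>(y, z). \<tau> y z) ` (points_until s \<times> points_until s)"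
  have X: "finite X" unfolding X_def using finite_points_until by blast
  have "W (Max X) y z" if "y \<in> points_until s" "z \<in> points_until s" "y < z" for y z
  proof -
    have "\<tau> y z \<in> X" using that by (auto simp: X_def)
    then have "points_until (\<tau> y z) \<subseteq> points_until (Max X)" using X by (intro points_until_mono) simp
    then show ?thesis using \<tau>[OF that] unfolding W_def by blast
  qed
  then show thesis using that unfolding W_def by blast
qed

text \<open>The parameter \<open>c\<close>, and with it the times \<open>t k\<close>, is fixed
  before \<open>a\<close>. Hence \<open>\<Phi>\<close> must provide points in the windows of all
  gaps at a given time, not just of the one that will contain \<open>a\<close>.\<close>

lemma gap_ratios_almost_naturals:
  obtains c a v where "gap_ratios c a = range v" "\<And>k::nat. \<bar>v k - real (k + 2)\<bar> < 1 / real (k + 2)"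
proof -
  \<comment> \<open>The target ratio at stage \<open>k\<close> is \<open>k + 2\<close> because
    windows require a ratio of at least 2.\<close>
  define lo where "lo k y z = y + (z - y) / (real (k + 2) + 1 / real (k + 2))" for k y z
  define hi where "hi k y z = y + (z - y) / (real (k + 2) - 1 / real (k + 2))" for k y z
  define late where "late k s T \<longleftrightarrow> (\<forall>y z. y \<in> points_until s \<longrightarrow> z \<in> points_until s \<longrightarrow> y < z \<longrightarrow>
    (\<exists>y' z'. y' \<in> points_until T \<and> z' \<in> points_until T \<and> lo k y z < y' \<and> y' < z' \<and> z' < hi k y z))" for k s T
  have ex: "\<exists>T. late k s T" for k s
  proof -
    have "2 \<le> real (k + 2)" by simp
    then show ?thesis
      unfolding late_def lo_def hi_def by (rule two_points_in_window[of _ s]) blast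
  qed
  define \<Phi> where "\<Phi> k s = (SOME T. late k s T)" for k s
  have \<Phi>: "late k s (\<Phi> k s)" for k s
    unfolding \<Phi>_def using ex by (rule someI_ex)
  obtain c t where c: "record_times c = range t" and t: "\<And>k. \<Phi> k (t k) < t (Suc k)"
    using sparse_record_times[of \<Phi>] by blast
  define I where "I n x = (case x of (y, z) \<Rightarrow> y \<in> points_until (t n) \<and> z \<in> points_until (t n) \<and> y < z \<and>
    (\<forall>w. w \<in> points_until (t n) \<longrightarrow> \<not> (y < w \<and> w < z)))" for n and x :: "real \<times> real"
  define R where "R n x x' = (case (x, x') of ((y, z), (y', z')) \<Rightarrow> lo n y z < y' \<and> z' < hi n y z)"
    for n and x x' :: "real \<times> real"
  have start: "\<exists>x. I 0 x"
  proof -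
    have "0 \<in> points_until (t 0)" "1 \<in> points_until (t 0)" by (auto simp: points_until_def)
    then obtain z where "z \<in> points_until (t 0)" "0 < z"
        "\<And>w. w \<in> points_until (t 0) \<Longrightarrow> \<not> (0 < w \<and> w < z)"
      using next_point[of 0 "t 0" 1] zero_less_one by metis
    then have "I 0 (0, z)" using \<open>0 \<in> points_until (t 0)\<close> by (simp add: I_def)
    then show ?thesis by blast
  qed
  have step: "\<exists>x'. I (Suc n) x' \<and> R n x x'" if "I n x" for n x
  proof -
    obtain y z where x: "x = (y, z)" by (cases x)
    have "y \<in> points_until (t n)" "z \<in> points_until (t n)" "y < z" using that by (auto simp: I_def x)
    then obtain y' z' where yz: "y' \<in> points_until (\<Phi> n (t n))" "z' \<in> points_until (\<Phi> n (t n))"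
        "lo n y z < y'" "y' < z'" "z' < hi n y z"
      using \<Phi>[of n "t n"] unfolding late_def by blast
    then have "y' \<in> points_until (t (Suc n))" "z' \<in> points_until (t (Suc n))"
      using points_until_mono[of "\<Phi> n (t n)" "t (Suc n)"] t[of n] by auto
    \<comment> \<open>Further points may separate \<open>y'\<close> from \<open>z'\<close> at time
      \<open>t (Suc n)\<close>. The successor \<open>z''\<close> of \<open>y'\<close> is at most
      \<open>z'\<close>, so it still lies below \<open>hi n y z\<close>.\<close>
    then obtain z'' where "z'' \<in> points_until (t (Suc n))" "y' < z''" "z'' \<le> z'"
        "\<And>w. w \<in> points_until (t (Suc n)) \<Longrightarrow> \<not> (y' < w \<and> w < z'')"
      using next_point yz(4) by blast
    then have "I (Suc n) (y', z'') \<and> R n x (y', z'')"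
      using \<open>y' \<in> points_until (t (Suc n))\<close> yz by (auto simp: I_def R_def x)
    then show ?thesis by blast
  qed
  obtain f where f: "\<And>n. I n (f n)" "\<And>n. R n (f n) (f (Suc n))"
    using dependent_nat_choice[of I R, OF start step] by blast
  define y z where "y n = fst (f n)" and "z n = snd (f n)" for n
  have f_eq: "f n = (y n, z n)" for n by (simp add: y_def z_def)
  have yz: "y n \<in> points_until (t n)" "z n \<in> points_until (t n)" "y n < z n"
      and none: "w \<in> points_until (t n) \<Longrightarrow> \<not> (y n < w \<and> w < z n)" for n w
    using f(1)[of n] by (auto simp: I_def f_eq)
  have R: "lo n (y n) (z n) < y (Suc n)" "z (Suc n) < hi n (y n) (z n)" for n
    using f(2)[of n] by (auto simp: R_def f_eq)
  have w: "y n < lo n (y n) (z n)" "hi n (y n) (z n) < z n" for n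
    unfolding lo_def hi_def using window_bounds[OF yz(3)[of n], of "real (n + 2)"] by auto
  obtain a where a: "\<And>n. y n < a" "\<And>n. a < z n"
    using nested_open_intervals[of y z] R w yz(3) by (metis order.strict_trans)
  define v where "v n = (z n - y n) / (a - y n)" for n
  have "\<bar>v k - real (k + 2)\<bar> < 1 / real (k + 2)" for k
    unfolding v_def using R[of k] a(1)[of "Suc k"] a(2)[of "Suc k"]
    by (intro ratio_window[OF yz(3)]) (auto simp: lo_def hi_def)
  moreover have "gap_ratios c a = range v"
  proof (intro equalityI subsetI)
    fix u assume "u \<in> range v"
    then obtain n where "u = v n" by blast
    then have "u * (a - y n) = z n - y n" using a(1)[of n] by (simp add: v_def)
    then have "\<exists>y z. y \<in> points_until (t n) \<and> z \<in> points_until (t n) \<and> y < a \<and> a < z \<and>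
        (\<forall>w. w \<in> points_until (t n) \<longrightarrow> \<not> (y < w \<and> w < z)) \<and> u * (a - y) = z - y"
      using yz(1,2)[of n] none[of _ n] a[of n] by (rule_tac exI[of _ "y n"], rule_tac exI[of _ "z n"]) blast
    then show "u \<in> gap_ratios c a" unfolding gap_ratios_def c by blast
  next
    fix u assume "u \<in> gap_ratios c a"
    then obtain n y' z' where *: "y' \<in> points_until (t n)" "z' \<in> points_until (t n)" "y' < a" "a < z'"
        "\<And>w. w \<in> points_until (t n) \<Longrightarrow> \<not> (y' < w \<and> w < z')" "u * (a - y') = z' - y'"
      unfolding gap_ratios_def c by blast
    have "y' = y n" "z' = z n"
    proof -
      have "\<not> y' < y n" "\<not> z n < z'" using *(4,5) *(3) yz(1,2,3)[of n] a[of n] by force+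
      moreover have "\<not> y n < y'" "\<not> z' < z n" using none[of _ n] *(1-4) a[of n] by force+
      ultimately show "y' = y n" "z' = z n" by linarith+
    qed
    then have "u = v n" using *(3,6) by (simp add: v_def field_simps)
    then show "u \<in> range v" by blast
  qed
  ultimately show thesis using that by blast
qed

end

text \<open>A formula has access to the set \<open>range v\<close> but not to its numbering, so
  shifts by \<open>x\<close> are tested on large values, where the errors vanish. Conversely, such
  an \<open>x\<close> is a limit of differences of indices, and the integers are closed.\<close>

lemma Ints_eq_asymptotic_differences:
  fixes v :: "nat \<Rightarrow> real"
  assumes v: "\<And>k. \<bar>v k - real (k + 2)\<bar> < 1 / real (k + 2)"
  shows "\<int> = {x. \<forall>\<epsilon>. 0 < \<epsilon> \<longrightarrow> (\<exists>r. \<forall>u. u \<in> range v \<and> r < u \<longrightarrow>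
    (\<exists>w. w \<in> range v \<and> w - u - x < \<epsilon> \<and> u + x - w < \<epsilon>))}" (is "_ = ?R")
proof (intro equalityI subsetI)
  have inv: "1 / real (k + 2) \<le> 1 / real (K + 1)" if "K \<le> k" for k K
    using that by (simp add: frac_le)
  have arch: "\<exists>K. 1 / real (K + 1) < \<delta>" if "0 < \<delta>" for \<delta>
    using reals_Archimedean[OF that] by (simp add: inverse_eq_divide)
  have bounds: "real k + 1 < v k \<and> v k < real k + 3" for k
  proof -
    have "1 / real (k + 2) \<le> 1" by simp
    then show ?thesis using v[of k] unfolding abs_less_iff of_nat_add by linarith
  qed
  {
    fix x :: real assume "x \<in> \<int>"
    then obtain m where m: "x = of_int m" by (auto elim: Ints_cases)
    have "\<exists>r. \<forall>u. u \<in> range v \<and> r < u \<longrightarrow> (\<exists>w. w \<in> range v \<and> w - u - x < \<epsilon> \<and> u + x - w < \<epsilon>)"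
      if \<epsilon>: "0 < \<epsilon>" for \<epsilon>
    proof -
      obtain K where K: "1 / real (K + 1) < \<epsilon> / 2"
        using arch[of "\<epsilon> / 2"] \<epsilon> by auto
      have "\<exists>w. w \<in> range v \<and> w - v k - x < \<epsilon> \<and> v k + x - w < \<epsilon>"
        \<comment> \<open>As \<open>v k < k + 3\<close>, this forces \<open>k > K + |x|\<close>, so
          the shifted index \<open>k + m\<close> is still at least \<open>K\<close>.\<close>
        if k: "real K + \<bar>x\<bar> + 3 < v k" for k
      proof -
        have "real_of_int (int K + \<bar>m\<bar>) < of_int (int k)" using k bounds[of k] by (simp add: m)
        then have km: "int K + \<bar>m\<bar> < int k" by (simp only: of_int_less_iff)
        define j where "j = nat (int k + m)"
        have j: "int j = int k + m" "K \<le> j" "K \<le> k" using km by (auto simp: j_def)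
        have "real j = real k + x" using j(1) m by (metis of_int_add of_int_of_nat_eq)
        then have "v j - v k - x < \<epsilon> \<and> v k + x - v j < \<epsilon>"
          using v[of j] v[of k] inv[OF j(2)] inv[OF j(3)] K by (auto simp: abs_less_iff)
        then show ?thesis by blast
      qed
      then show ?thesis by blast
    qed
    then show "x \<in> ?R" by blast
  next
    fix x assume x: "x \<in> ?R"
    have "\<exists>i\<in>\<int>. dist i x < \<epsilon>" if \<epsilon>: "0 < \<epsilon>" for \<epsilon>
    proof -
      obtain K where K: "1 / real (K + 1) < \<epsilon> / 3"
        using arch[of "\<epsilon> / 3"] \<epsilon> by auto
      \<comment> \<open>The bound 1 forces the index \<open>j\<close> of the matching value above
        \<open>K\<close>; the two deviations of \<open>v\<close> and the mismatch get
        \<open>\<epsilon> / 3\<close> each.\<close>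
      have "0 < min 1 (\<epsilon> / 3)" using \<epsilon> by simp
      then obtain r where r: "\<And>u. u \<in> range v \<Longrightarrow> r < u \<Longrightarrow>
          (\<exists>w. w \<in> range v \<and> w - u - x < min 1 (\<epsilon> / 3) \<and> u + x - w < min 1 (\<epsilon> / 3))"
        using x unfolding mem_Collect_eq by meson
      obtain k where k: "max r (real K + \<bar>x\<bar>) + 3 < real k" using reals_Archimedean2 by blast
      then have "r < v k" using bounds[of k] by linarith
      then obtain j where j: "v j - v k - x < min 1 (\<epsilon> / 3)" "v k + x - v j < min 1 (\<epsilon> / 3)"
        using r[of "v k"] by blast
      have "real K < real j" using j k bounds[of k] bounds[of j] by linarith
      then have "K \<le> j" "K \<le> k" using k by auto
      then have "dist (real j - real k) x < \<epsilon>"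
        using v[of j] v[of k] inv[of K j] inv[of K k] K j by (auto simp: dist_real_def abs_less_iff)
      moreover have "real j - real k \<in> \<int>" by simp
      ultimately show ?thesis by blast
    qed
    then have "x \<in> closure \<int>" unfolding closure_approachable by blast
    then show "x \<in> \<int>" using closed_Ints by simp
  }
qed

context real_field_expansion
begin

lemma definable_Ints_of_timed_dense_points:
  assumes "timed_dense_points P" "definable2 P"
  shows "definable1 M \<int>"
proof -
  interpret timed_dense_points P by fact
  obtain c a v where V: "gap_ratios c a = range v" and v: "\<And>k::nat. \<bar>v k - real (k + 2)\<bar> < 1 / real (k + 2)"
    using gap_ratios_almost_naturals by metis
  note P = definable2D[OF assms(2)]
  have rec: "definable_pred M (\<lambda>e. e i \<in> record_times c)" for i
    unfolding record_times_def mem_Collect_eq by (intro definable_intros P)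
  have pts: "definable_pred M (\<lambda>e. e i \<in> points_until (e j))" for i j
    unfolding points_until_def mem_Collect_eq by (intro definable_intros P)
  have gaps: "definable_pred M (\<lambda>e. e i \<in> range v)" for i
    unfolding V[symmetric] gap_ratios_def mem_Collect_eq by (intro definable_intros rec pts)
  show ?thesis
    by (rule definable1_of_pred, subst Ints_eq_asymptotic_differences[OF v], unfold mem_Collect_eq)
      (intro definable_intros gaps)
qed

end

section \<open>Ratios of differences and Minkowski dimension\<close>

definition separated :: "real \<Rightarrow> real set \<Rightarrow> bool" where
  "separated r G \<longleftrightarrow> (\<forall>x\<in>G. \<forall>y\<in>G. x \<noteq> y \<longrightarrow> r \<le> \<bar>x - y\<bar>)"

text \<open>For bounded \<open>X\<close>, the upper Minkowski dimension is positive iff \<open>X\<close> is large for some \<open>s > 0\<close>.\<close>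

definition large :: "real \<Rightarrow> real set \<Rightarrow> bool" where
  "large s X \<longleftrightarrow> (\<forall>r0>0. \<exists>r G. 0 < r \<and> r < r0 \<and> G \<subseteq> X \<and> finite G \<and> separated r G \<and>
     (1 / r) powr s \<le> real (card G))"

text \<open>Separated points fall into different cells of length \<open>r\<close>, numbered by the
  floor function.\<close>

lemma separated_bounded:
  assumes "separated r G" "G \<subseteq> {a..b}" "0 < r" "a \<le> b"
  shows "finite G" "real (card G) \<le> (b - a) / r + 1"
proof -
  define f where "f x = \<lfloor>(x - a) / r\<rfloor>" for x
  have inj: "inj_on f G"
  proof (rule inj_onI, rule ccontr)
    fix x y assume xy: "x \<in> G" "y \<in> G" "f x = f y" "x \<noteq> y"
    then have "r \<le> \<bar>x - y\<bar>" using assms(1) by (auto simp: separated_def)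
    moreover have "\<bar>(x - a) / r - (y - a) / r\<bar> < 1"
      using xy(3) unfolding f_def by linarith
    then have "\<bar>x - y\<bar> / r < 1" using assms(3) by (simp add: diff_divide_distrib[symmetric] abs_divide)
    ultimately show False using assms(3) by (simp add: divide_less_eq)
  qed
  have sub: "f ` G \<subseteq> {0..\<lfloor>(b - a) / r\<rfloor>}"
  proof
    fix k assume "k \<in> f ` G"
    then obtain x where "k = f x" "a \<le> x" "x \<le> b" using assms(2) by auto
    then show "k \<in> {0..\<lfloor>(b - a) / r\<rfloor>}"
      using assms(3) by (auto simp: f_def intro!: floor_mono divide_right_mono)
  qed
  show "finite G" using inj sub by (meson finite_atLeastAtMost_int finite_imageD finite_subset)
  have "card G \<le> card {0..\<lfloor>(b - a) / r\<rfloor>}" using card_inj_on_le[OF inj sub] by simp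
  also have "real \<dots> = of_int \<lfloor>(b - a) / r\<rfloor> + 1" using assms(3,4) by simp
  also have "\<dots> \<le> (b - a) / r + 1" by simp
  finally show "real (card G) \<le> (b - a) / r + 1" by simp
qed

text \<open>The number of \<open>r\<close>-separated points is at most linear in
  \<open>1 / r\<close>, hence below its square for small \<open>r\<close>. The crude bound 2 absorbs
  the constants and suffices to stop the growth of the exponent.\<close>

lemma large_bounded_exponent:
  assumes "large s X" "bounded X"
  shows "s < 2"
proof (rule ccontr)
  assume "\<not> s < 2"
  obtain B where B: "0 < B" "\<And>x. x \<in> X \<Longrightarrow> \<bar>x\<bar> \<le> B"
    using assms(2) unfolding bounded_pos by auto
  have "0 < 1 / (2 * B + 1)" using B by simp
  then obtain r G where r: "0 < r" "r < 1 / (2 * B + 1)" and G: "G \<subseteq> X" "separated r G"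
      "(1 / r) powr s \<le> real (card G)"
    using assms(1) unfolding large_def by blast
  define q where "q = 1 / r"
  have q: "2 * B + 1 < q" unfolding q_def using r B by (simp add: field_simps)
  have "G \<subseteq> {-B..B}" using G(1) B(2) by (force simp: abs_le_iff)
  then have "real (card G) \<le> (B - (-B)) / r + 1"
    using r B by (intro separated_bounded(2)[OF G(2)]) auto
  then have "q powr s \<le> 2 * B * q + 1" using G(3) by (simp add: q_def)
  moreover have "q powr 2 \<le> q powr s" using q B \<open>\<not> s < 2\<close> by (intro powr_mono) auto
  moreover have "q powr 2 = q * q" using q B by (simp add: powr_numeral power2_eq_square)
  moreover have "(2 * B + 1) * q < q * q" using q B by (intro mult_strict_right_mono) auto
  ultimately show False using q B by (simp add: algebra_simps)
qed

text \<open>If \<open>x\<close> has distance at least \<open>\<epsilon>\<close> from all ratios of differences of \<open>X\<close>, then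
  \<open>(a, b) \<mapsto> a + x b\<close> maps pairs of \<open>r\<close>-separated points to \<open>\<epsilon> r\<close>-separated points.\<close>

lemma large_linear_image:
  assumes X: "large s X" "0 < s" and pq: "p < q"
    and miss: "\<And>a b c d. a \<in> X \<Longrightarrow> b \<in> X \<Longrightarrow> c \<in> X \<Longrightarrow> d \<in> X \<Longrightarrow> c \<noteq> d \<Longrightarrow>
      \<not> (p < (a - b) / (c - d) \<and> (a - b) / (c - d) < q)"
  shows "\<exists>x. large (3 / 2 * s) {z. \<exists>a\<in>X. \<exists>b\<in>X. z = a + x * b}"
proof -
  define x where "x = (p + q) / 2"
  \<comment> \<open>Half the length of the missed interval bounds the distance from its midpoint
    \<open>x\<close> to any ratio; the cap 1 covers pairs with equal second coordinate.\<close>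
  define \<epsilon> where "\<epsilon> = min 1 ((q - p) / 2)"
  have \<epsilon>: "0 < \<epsilon>" "\<epsilon> \<le> 1" "\<epsilon> \<le> (q - p) / 2" using pq unfolding \<epsilon>_def by (simp, simp, linarith)
  have "\<exists>r' G'. 0 < r' \<and> r' < r0 \<and> G' \<subseteq> {z. \<exists>a\<in>X. \<exists>b\<in>X. z = a + x * b} \<and> finite G' \<and>
     separated r' G' \<and> (1 / r') powr (3 / 2 * s) \<le> real (card G')" if "0 < r0" for r0
  proof -
    \<comment> \<open>For \<open>r < \<epsilon> ^ 3\<close> the loss \<open>1 / \<epsilon>\<close>
      is at most \<open>(1 / r) powr (1 / 3)\<close>. Since 4/3 times 3/2 is 2, squaring the number
      of points pays for an exponent growth by 3/2.\<close>
    have "0 < min r0 (\<epsilon> ^ 3)" using that \<epsilon> by simp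
    then obtain r G where r: "0 < r" "r < min r0 (\<epsilon> ^ 3)" and G: "G \<subseteq> X" "finite G" "separated r G"
        "(1 / r) powr s \<le> real (card G)"
      using X(1) unfolding large_def by blast
    define f where "f = (\<lambda>(a, b). a + x * b)"
    have far: "\<epsilon> * r \<le> \<bar>f u - f v\<bar>" if uv: "u \<in> G \<times> G" "v \<in> G \<times> G" "u \<noteq> v" for u v
    proof -
      obtain a b a' b' where e: "u = (a, b)" "v = (a', b')" by (cases u, cases v)
      have mem: "a \<in> G" "b \<in> G" "a' \<in> G" "b' \<in> G" using uv by (auto simp: e)
      have fe: "f u - f v = (a - a') + x * (b - b')" by (simp add: f_def e algebra_simps)
      show ?thesis
      proof (cases "b = b'")
        case True
        then have "r \<le> \<bar>a - a'\<bar>" using uv mem G(3) by (auto simp: e separated_def)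
        moreover have "\<epsilon> * r \<le> 1 * r" using \<epsilon> r by (intro mult_right_mono) auto
        ultimately show ?thesis using True fe by simp
      next
        case False
        \<comment> \<open>This is the coefficient in place of \<open>x\<close> for which
          \<open>u\<close> and \<open>v\<close> would have equal images.\<close>
        define \<rho> where "\<rho> = (a - a') / (b' - b)"
        have "\<not> (p < \<rho> \<and> \<rho> < q)" unfolding \<rho>_def using miss[of a a' b' b] mem G(1) False by auto
        then have 1: "\<epsilon> \<le> \<bar>\<rho> - x\<bar>" using \<epsilon>(3) unfolding x_def by (auto simp: field_simps)
        have 2: "r \<le> \<bar>b' - b\<bar>" using False mem G(3) by (auto simp: separated_def)
        have "f u - f v = (\<rho> - x) * (b' - b)" using False by (simp add: fe \<rho>_def field_simps)
        then have "\<bar>f u - f v\<bar> = \<bar>\<rho> - x\<bar> * \<bar>b' - b\<bar>" by (simp add: abs_mult)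
        then show ?thesis using mult_mono[OF 1 2] r by simp
      qed
    qed
    have pos: "0 < \<epsilon> * r" using \<epsilon> r by simp
    have inj: "inj_on f (G \<times> G)"
    proof (rule inj_onI, rule ccontr)
      fix u v assume "u \<in> G \<times> G" "v \<in> G \<times> G" "f u = f v" "u \<noteq> v"
      then show False using far[of u v] pos by simp
    qed
    have card: "real (card (f ` (G \<times> G))) = (real (card G))\<^sup>2"
      by (simp add: card_image[OF inj] card_cartesian_product power2_eq_square)
    have sep: "separated (\<epsilon> * r) (f ` (G \<times> G))"
      unfolding separated_def using far by (metis (no_types, lifting) imageE)
    have "1 / \<epsilon> = ((1 / \<epsilon>) ^ 3) powr (1 / 3)"
      using \<epsilon> by (simp add: powr_powr flip: powr_numeral)
    also have "\<dots> \<le> (1 / r) powr (1 / 3)"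
      using r \<epsilon> by (intro powr_mono2) (auto simp: field_simps)
    finally have "1 / (\<epsilon> * r) \<le> (1 / r) powr (1 / 3) * (1 / r) powr 1"
      using r by (simp add: field_simps)
    also have "\<dots> = (1 / r) powr (4 / 3)" by (simp only: powr_add[symmetric]) simp
    finally have "(1 / (\<epsilon> * r)) powr (3 / 2 * s) \<le> ((1 / r) powr (4 / 3)) powr (3 / 2 * s)"
      using X(2) pos by (intro powr_mono2) auto
    also have "\<dots> = (1 / r) powr (s + s)" by (simp add: powr_powr)
    also have "\<dots> = ((1 / r) powr s)\<^sup>2" by (simp only: powr_add power2_eq_square)
    also have "\<dots> \<le> (real (card G))\<^sup>2" using G(4) by (intro power_mono) auto
    finally have "(1 / (\<epsilon> * r)) powr (3 / 2 * s) \<le> real (card (f ` (G \<times> G)))" by (simp only: card)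
    moreover have "\<epsilon> * r < r0" using mult_right_mono[OF \<epsilon>(2), of r] r by linarith
    moreover have "f ` (G \<times> G) \<subseteq> {z. \<exists>a\<in>X. \<exists>b\<in>X. z = a + x * b}"
      using G(1) by (auto simp: f_def)
    moreover have "finite (f ` (G \<times> G))" using G(2) by simp
    ultimately show ?thesis using pos sep by blast
  qed
  then show ?thesis unfolding large_def by blast
qed

text \<open>Greedy choice: fewer than \<open>cover_num A r\<close> balls leave a point of
  \<open>A\<close> uncovered. The uncovered region is open, so it also contains a point of
  \<open>D\<close>, which can be added.\<close>

lemma separated_of_cover_num:
  assumes "A \<subseteq> closure D" "0 < r" "n \<le> cover_num A r"
  shows "\<exists>G\<subseteq>D. finite G \<and> card G = n \<and> separated r G"
  using assms(3)
proof (induction n)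
  case 0
  show ?case by (intro exI[of _ "{}"]) (simp add: separated_def)
next
  case (Suc n)
  then obtain G where G: "G \<subseteq> D" "finite G" "card G = n" "separated r G" by auto
  have "n < cover_num A r" using Suc by simp
  then have "\<not> A \<subseteq> (\<Union>c\<in>G. cball c r)"
    using not_less_Least[of n] G(2,3) unfolding cover_num_def by blast
  then obtain x where x: "x \<in> A" "x \<in> - (\<Union>c\<in>G. cball c r)" by blast
  moreover have "open (- (\<Union>c\<in>G. cball c r))" using G(2) by (intro open_Compl closed_UN) auto
  ultimately have "- (\<Union>c\<in>G. cball c r) \<inter> D \<noteq> {}"
    using assms(1) open_Int_closure_eq_empty[of "- (\<Union>c\<in>G. cball c r)" D] by blast
  then obtain d where d: "d \<in> D" "d \<notin> (\<Union>c\<in>G. cball c r)" by blast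
  have far: "r < \<bar>c - d\<bar>" if "c \<in> G" for c
    using d(2) that by (auto simp: dist_real_def not_le)
  have "d \<notin> G" using assms(2) far[of d] by force
  moreover have "separated r (insert d G)"
    using G(4) far by (force simp: separated_def abs_minus_commute)
  ultimately show ?case using G d(1) by (intro exI[of _ "insert d G"]) auto
qed

text \<open>The passage to \<open>D\<close> matters because it is the gap ends, dense in
  \<open>A\<close>, that appear in time.\<close>

lemma large_of_not_M_null:
  assumes "bounded A" "\<not> M_null A" "A \<subseteq> closure D"
  shows "\<exists>s>0. large s D"
proof -
  let ?f = "\<lambda>r. if cover_num A r = 0 then - \<infinity> else ereal (ln (real (cover_num A r)) / ln (1 / r))"
  have "\<not> Limsup (at_right 0) ?f \<le> 0"
    using assms(1,2) unfolding M_null_def upper_minkowski_dim_def by blast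
  then obtain y where y: "0 < y" "\<not> eventually (\<lambda>r. ?f r < y) (at_right 0)"
    unfolding Limsup_le_iff by blast
  obtain s where s: "0 < ereal s" "ereal s < y" using ereal_dense2[OF y(1)] by blast
  have "large s D" unfolding large_def
  proof (intro allI impI)
    fix r0 :: real assume "0 < r0"
    \<comment> \<open>The cap 1 on \<open>r\<close> makes \<open>ln (1 / r)\<close>
      positive.\<close>
    have "\<not> (\<forall>r. 0 < r \<and> r < min r0 1 \<longrightarrow> ?f r < y)"
      using y(2) \<open>0 < r0\<close> unfolding eventually_at_right_field by (metis min_less_iff_conj zero_less_one)
    then obtain r where r: "0 < r" "r < r0" "r < 1" and f: "\<not> ?f r < y" by auto
    have "- \<infinity> < y" using y(1) by (cases y) auto
    then have N: "cover_num A r \<noteq> 0" using f by (intro notI) simp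
    then have "ereal s < ereal (ln (real (cover_num A r)) / ln (1 / r))"
      using f s(2) by (simp only: if_False not_less less_le_trans)
    then have "s * ln (1 / r) < ln (real (cover_num A r))"
      using r by (simp add: pos_less_divide_eq)
    then have "exp (s * ln (1 / r)) < real (cover_num A r)"
      using N by (metis exp_less_cancel_iff exp_ln of_nat_0_less_iff gr0I)
    then have "(1 / r) powr s \<le> real (cover_num A r)"
      using r by (simp add: powr_def)
    moreover obtain G where "G \<subseteq> D" "finite G" "card G = cover_num A r" "separated r G"
      using separated_of_cover_num[OF assms(3) r(1) order.refl] by blast
    ultimately show "\<exists>r G. 0 < r \<and> r < r0 \<and> G \<subseteq> D \<and> finite G \<and> separated r G \<and> (1 / r) powr s \<le> real (card G)"
      using r by metis
  qed
  then show ?thesis using s(1) by auto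
qed

section \<open>Points appearing in time, their combinations and ratios\<close>

definition point_set :: "(real \<Rightarrow> real \<Rightarrow> bool) \<Rightarrow> real set" where
  "point_set P = {y. \<exists>t. P t y}"

text \<open>Positive times turn a bound on a sum of times into a bound on each summand. Finiteness
  thus passes to combinations whose time is the sum of the times of their constituents.\<close>

definition timed_points :: "(real \<Rightarrow> real \<Rightarrow> bool) \<Rightarrow> bool" where
  "timed_points P \<longleftrightarrow> (\<forall>T. finite {(t, y). P t y \<and> t \<le> T}) \<and> (\<forall>t y. P t y \<longrightarrow> 0 < t) \<and> bounded (point_set P)"

definition linear_combinations :: "real \<Rightarrow> (real \<Rightarrow> real \<Rightarrow> bool) \<Rightarrow> real \<Rightarrow> real \<Rightarrow> bool" where
  "linear_combinations x P s z \<longleftrightarrow>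
     (\<exists>t y t' y'. P t y \<and> P t' y' \<and> s = t + t' \<and> z = y + x * y')"

lemma point_set_linear_combinations:
  "point_set (linear_combinations x P) = {z. \<exists>a\<in>point_set P. \<exists>b\<in>point_set P. z = a + x * b}"
  unfolding point_set_def linear_combinations_def by blast

lemma timed_points_linear_combinations:
  assumes "timed_points P"
  shows "timed_points (linear_combinations x P)"
proof -
  have fin: "finite {(t, y). P t y \<and> t \<le> T}" and pos: "P t y \<Longrightarrow> 0 < t" for T t y
    using assms by (auto simp: timed_points_def)
  have "finite {(s, z). linear_combinations x P s z \<and> s \<le> T}" for T
  proof -
    define F where "F = {(t, y). P t y \<and> t \<le> T}"
    have "{(s, z). linear_combinations x P s z \<and> s \<le> T} \<subseteq>
        (\<lambda>((t, y), (t', y')). (t + t', y + x * y')) ` (F \<times> F)"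
    proof (clarsimp simp: linear_combinations_def)
      fix t y t' y' assume *: "P t y" "P t' y'" "t + t' \<le> T"
      then have "(t, y) \<in> F" "(t', y') \<in> F" using pos[OF *(1)] pos[OF *(2)] by (auto simp: F_def)
      then show "(t + t', y + x * y') \<in> (\<lambda>((t, y), (t', y')). (t + t', y + x * y')) ` (F \<times> F)"
        by (intro image_eqI[of _ _ "((t, y), (t', y'))"]) auto
    qed
    then show ?thesis using fin[of T] unfolding F_def by (meson finite_SigmaI finite_imageI finite_subset)
  qed
  moreover have "bounded (point_set (linear_combinations x P))"
  proof -
    obtain B where B: "0 < B" "\<And>y. y \<in> point_set P \<Longrightarrow> \<bar>y\<bar> \<le> B"
      using assms unfolding timed_points_def bounded_pos by auto
    have "\<bar>a + x * b\<bar> \<le> B + \<bar>x\<bar> * B" if "a \<in> point_set P" "b \<in> point_set P" for a b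
    proof -
      have "\<bar>a + x * b\<bar> \<le> \<bar>a\<bar> + \<bar>x\<bar> * \<bar>b\<bar>" using abs_triangle_ineq[of a "x * b"] by (simp add: abs_mult)
      then show ?thesis using B(2)[OF that(1)] mult_left_mono[OF B(2)[OF that(2)], of "\<bar>x\<bar>"] by simp
    qed
    then show ?thesis unfolding point_set_linear_combinations bounded_iff by (auto intro!: exI[of _ "B + \<bar>x\<bar> * B"])
  qed
  moreover have "0 < s" if "linear_combinations x P s z" for s z
    using that pos unfolding linear_combinations_def by (metis add_pos_pos)
  ultimately show ?thesis by (simp add: timed_points_def)
qed

definition unit_ratios :: "(real \<Rightarrow> real \<Rightarrow> bool) \<Rightarrow> real \<Rightarrow> real \<Rightarrow> bool" where
  "unit_ratios P s z \<longleftrightarrow> (\<exists>t1 a t2 b t3 c t4 d. P t1 a \<and> P t2 b \<and> P t3 c \<and> P t4 d \<and>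
     s = t1 + t2 + t3 + t4 \<and> c \<noteq> d \<and> z * (c - d) = a - b \<and> 0 < z \<and> z < 1)"

definition ratios_dense :: "real set \<Rightarrow> bool" where
  "ratios_dense X \<longleftrightarrow> (\<forall>p q. 0 \<le> p \<longrightarrow> p < q \<longrightarrow> q \<le> 1 \<longrightarrow>
     (\<exists>a\<in>X. \<exists>b\<in>X. \<exists>c\<in>X. \<exists>d\<in>X. c \<noteq> d \<and> p < (a - b) / (c - d) \<and> (a - b) / (c - d) < q))"

lemma timed_dense_points_unit_ratios:
  assumes "timed_points P" "ratios_dense (point_set P)"
  shows "timed_dense_points (unit_ratios P)"
proof
  have fin: "finite {(t, y). P t y \<and> t \<le> T}" and pos: "P t y \<Longrightarrow> 0 < t" for T t y
    using assms by (auto simp: timed_points_def)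
  fix T
  define F where "F = {(t, y). P t y \<and> t \<le> T}"
  define g where "g = (\<lambda>((t1::real, a::real), (t2, b), (t3, c), (t4, d)). (t1 + t2 + t3 + t4, (a - b) / (c - d)))"
  have "{(s, z). unit_ratios P s z \<and> s \<le> T} \<subseteq> g ` (F \<times> F \<times> F \<times> F)"
  proof (clarsimp simp: unit_ratios_def)
    fix z t1 a t2 b t3 c t4 d
    assume *: "P t1 a" "P t2 b" "P t3 c" "P t4 d" "t1 + t2 + t3 + t4 \<le> T" "c \<noteq> d" "z * (c - d) = a - b"
    then have "(t1, a) \<in> F" "(t2, b) \<in> F" "(t3, c) \<in> F" "(t4, d) \<in> F"
      using *(1-4)[THEN pos] by (auto simp: F_def)
    moreover have "z = (a - b) / (c - d)" using *(6,7) by (simp add: eq_divide_eq)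
    ultimately show "(t1 + t2 + t3 + t4, z) \<in> g ` (F \<times> F \<times> F \<times> F)"
      by (intro image_eqI[of _ _ "((t1, a), (t2, b), (t3, c), (t4, d))"]) (auto simp: g_def)
  qed
  then show "finite {(s, z). unit_ratios P s z \<and> s \<le> T}"
    using fin[of T] unfolding F_def by (meson finite_SigmaI finite_imageI finite_subset)
next
  fix t y assume "unit_ratios P t y"
  then show "0 < y \<and> y < 1" by (auto simp: unit_ratios_def)
next
  fix p q :: real assume pq: "0 \<le> p" "p < q" "q \<le> 1"
  obtain a b c d where *: "a \<in> point_set P" "b \<in> point_set P" "c \<in> point_set P" "d \<in> point_set P" "c \<noteq> d"
      "p < (a - b) / (c - d)" "(a - b) / (c - d) < q"
    using assms(2) pq unfolding ratios_dense_def by metis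
  obtain t1 t2 t3 t4 where "P t1 a" "P t2 b" "P t3 c" "P t4 d" using *(1-4) unfolding point_set_def by blast
  moreover have "(a - b) / (c - d) * (c - d) = a - b" using *(5) by simp
  moreover have "0 < (a - b) / (c - d)" "(a - b) / (c - d) < 1" using *(6,7) pq by linarith+
  ultimately have "unit_ratios P (t1 + t2 + t3 + t4) ((a - b) / (c - d))"
    unfolding unit_ratios_def using *(5) by metis
  then show "\<exists>t y. unit_ratios P t y \<and> p < y \<and> y < q" using * by blast
qed

section \<open>Gap ends of a bounded nowhere dense set\<close>

definition gap_ends :: "real set \<Rightarrow> real \<Rightarrow> real \<Rightarrow> bool" where
  "gap_ends B t y \<longleftrightarrow> (\<exists>u. u < y \<and> u \<in> closure B \<and> y \<in> closure B \<and>
     (\<forall>w. w \<in> B \<longrightarrow> \<not> (u < w \<and> w < y)) \<and> t * (y - u) = 1)"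

lemma gap_misses_closure:
  fixes u y :: real
  assumes "\<And>w. w \<in> B \<Longrightarrow> \<not> (u < w \<and> w < y)" "z \<in> closure B"
  shows "\<not> (u < z \<and> z < y)"
  using assms open_Int_closure_eq_empty[of "{u<..<y}" B] by auto

text \<open>Until time \<open>T\<close> only gaps of length at least \<open>1 / T\<close> count, and
  no right end lies inside another gap, so these right ends are \<open>1 / T\<close>-separated. A
  right end determines its gap and hence its time.\<close>

lemma timed_points_gap_ends:
  assumes "bounded B"
  shows "timed_points (gap_ends B)"
proof -
  have pos: "0 < t" if gap: "gap_ends B t y" for t y
  proof -
    obtain u where "u < y" "t * (y - u) = 1" using gap unfolding gap_ends_def by blast
    then show ?thesis by (metis diff_gt_0_iff_gt zero_less_mult_pos2 zero_less_one)
  qed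
  have bdd: "bounded (point_set (gap_ends B))"
    by (rule bounded_subset[OF bounded_closure[OF assms]]) (auto simp: point_set_def gap_ends_def)
  then obtain C where C: "0 < C" "\<And>y. y \<in> point_set (gap_ends B) \<Longrightarrow> \<bar>y\<bar> \<le> C" unfolding bounded_pos by auto
  have "finite {(t, y). gap_ends B t y \<and> t \<le> T}" for T
  proof -
    define Y where "Y = {(t, y). gap_ends B t y \<and> t \<le> T}"
    have sep: "1 / T \<le> y' - y" if Y: "(t, y) \<in> Y" "(t', y') \<in> Y" "y < y'" for t y t' y'
    proof -
      obtain u where u: "u < y'" "t' * (y' - u) = 1" and none: "\<And>w. w \<in> B \<Longrightarrow> \<not> (u < w \<and> w < y')"
        using Y(2) unfolding Y_def gap_ends_def by blast
      have "y \<in> closure B" using Y(1) by (auto simp: Y_def gap_ends_def)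
      then have "y \<le> u" using gap_misses_closure[OF none] Y(3) by (meson not_le)
      moreover have t': "0 < t'" "t' \<le> T" using Y(2) pos unfolding Y_def by blast+
      then have "y' - u = 1 / t'" using u by (simp add: field_simps)
      moreover have "1 / T \<le> 1 / t'" using t' by (simp add: frac_le)
      ultimately show ?thesis by linarith
    qed
    have inj: "inj_on snd Y"
    proof (rule inj_onI)
      fix p p' assume p: "p \<in> Y" "p' \<in> Y" "snd p = snd p'"
      obtain t t' y where e: "p = (t, y)" "p' = (t', y)" using p(3) by (cases p, cases p') auto
      obtain u where u: "u < y" "u \<in> closure B" "t * (y - u) = 1" and none: "\<And>w. w \<in> B \<Longrightarrow> \<not> (u < w \<and> w < y)"
        using p(1) unfolding Y_def gap_ends_def e by blast
      obtain u' where u': "u' < y" "u' \<in> closure B" "t' * (y - u') = 1" and none': "\<And>w. w \<in> B \<Longrightarrow> \<not> (u' < w \<and> w < y)"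
        using p(2) unfolding Y_def gap_ends_def e by blast
      have "u = u'"
        using gap_misses_closure[OF none u'(2)] gap_misses_closure[OF none' u(2)] u(1) u'(1) by linarith
      then have "t = t'" using u u' by (metis mult_cancel_right zero_neq_one mult_zero_right)
      then show "p = p'" by (simp add: e)
    qed
    show ?thesis
    proof (cases "0 < T")
      case True
      have "separated (1 / T) (snd ` Y)"
        unfolding separated_def
      proof (intro ballI impI)
        fix y y' assume "y \<in> snd ` Y" "y' \<in> snd ` Y" "y \<noteq> y'"
        then show "1 / T \<le> \<bar>y - y'\<bar>" using sep by (cases "y < y'") fastforce+
      qed
      moreover have "snd ` Y \<subseteq> {-C..C}"
        using C(2) by (fastforce simp: Y_def point_set_def abs_le_iff)
      ultimately have "finite (snd ` Y)" using separated_bounded(1)[of "1 / T" "snd ` Y" "-C" C] True C(1) by simp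
      then show ?thesis using inj finite_imageD unfolding Y_def by blast
    next
      case False
      then have "Y = {}" using pos by (force simp: Y_def)
      then have "finite Y" by simp
      then show ?thesis unfolding Y_def .
    qed
  qed
  then show ?thesis using pos bdd by (simp add: timed_points_def)
qed

text \<open>The extra point \<open>b\<close> makes the least element of the closure of \<open>A\<close> the right end of a bounded gap.\<close>

lemma gap_ends_dense:
  assumes "nowhere_dense A" "\<And>a. a \<in> A \<Longrightarrow> b < a"
  shows "A \<subseteq> closure (point_set (gap_ends (insert b A)))"
proof
  fix x assume x: "x \<in> A"
  define K where "K = closure (insert b A)"
  have K: "closed K" "K = insert b (closure A)" by (simp_all add: K_def closure_insert)
  have "\<exists>y\<in>point_set (gap_ends (insert b A)). dist y x < \<epsilon>" if "0 < \<epsilon>" for \<epsilon>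
  proof -
    \<comment> \<open>A point to the right of \<open>l\<close> is both close to \<open>x\<close> and
      to the right of \<open>b\<close>, so \<open>K\<close> has points on either side of it.\<close>
    define l where "l = max b (x - \<epsilon>)"
    have "l < x" using that assms(2)[OF x] by (simp add: l_def)
    have "\<not> {l<..<x} \<subseteq> closure A"
    proof
      assume "{l<..<x} \<subseteq> closure A"
      then have "{l<..<x} \<subseteq> interior (closure A)" by (simp add: interior_maximal)
      then show False using assms(1) \<open>l < x\<close> by (simp add: nowhere_dense_def)
    qed
    then obtain z where z: "l < z" "z < x" "z \<notin> closure A" unfolding subset_iff by auto
    then have "z \<notin> K" by (auto simp: K(2) l_def)
    \<comment> \<open>These are the ends of the gap of \<open>K\<close> around \<open>z\<close>.
      Since \<open>x\<close> is in \<open>K\<close>, the right end \<open>y\<close> lies between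
      \<open>z\<close> and \<open>x\<close>.\<close>
    define u where "u = Sup (K \<inter> {..z})"
    define y where "y = Inf (K \<inter> {z..})"
    have "b \<in> K \<inter> {..z}" using z by (auto simp: K(2) l_def)
    moreover have bdd1: "bdd_above (K \<inter> {..z})" by (auto simp: bdd_above_def)
    ultimately have u: "u \<in> K \<inter> {..z}"
      unfolding u_def using K(1) by (intro closed_contains_Sup) auto
    have "x \<in> K \<inter> {z..}" using z x closure_subset by (auto simp: K(2))
    moreover have bdd2: "bdd_below (K \<inter> {z..})" by (auto simp: bdd_below_def)
    ultimately have y: "y \<in> K \<inter> {z..}" and "y \<le> x"
      unfolding y_def using K(1) by (intro closed_contains_Inf closed_Int cInf_lower; auto)+
    have uz: "u < z" and zy: "z < y" using u y \<open>z \<notin> K\<close> by (auto simp: less_le)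
    have "\<not> (u < w \<and> w < y)" if "w \<in> insert b A" for w
    proof
      assume w: "u < w \<and> w < y"
      have "w \<in> K" using that closure_subset unfolding K_def by blast
      then consider "w \<in> K \<inter> {..z}" | "w \<in> K \<inter> {z..}" by force
      then show False
        using w cSup_upper[OF _ bdd1, of w] cInf_lower[OF _ bdd2, of w] by cases (auto simp: u_def y_def)
    qed
    then have "gap_ends (insert b A) (1 / (y - u)) y"
      unfolding gap_ends_def using u y uz zy by (intro exI[of _ u]) (auto simp: K_def)
    moreover have "dist y x < \<epsilon>" using \<open>y \<le> x\<close> zy z(1) by (simp add: dist_real_def l_def)
    ultimately show ?thesis unfolding point_set_def by blast
  qed
  then show "x \<in> closure (point_set (gap_ends (insert b A)))" unfolding closure_approachable by blast
qed

section \<open>Definability of the constructions and the iteration\<close>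

context real_field_expansion
begin

lemma definable2_linear_combinations:
  assumes "definable2 P"
  shows "definable2 (linear_combinations x P)"
  unfolding definable2_def linear_combinations_def
  by (intro allI definable_intros definable2D[OF assms])

lemma definable2_unit_ratios:
  assumes "definable2 P"
  shows "definable2 (unit_ratios P)"
  unfolding definable2_def unit_ratios_def
  by (intro allI definable_intros definable2D[OF assms])

lemma definable2_gap_ends:
  assumes "definable1 M A"
  shows "definable2 (gap_ends (insert b A))"
proof -
  have B: "definable_pred M (\<lambda>e. e i \<in> insert b A)" for i
    unfolding insert_iff by (intro definable_intros definable_pred_mem assms)
  have "x \<in> closure B \<longleftrightarrow> (\<forall>\<epsilon>. 0 < \<epsilon> \<longrightarrow> (\<exists>w. w \<in> B \<and> w - x < \<epsilon> \<and> x - w < \<epsilon>))" for x :: real and B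
    unfolding closure_approachable dist_real_def abs_less_iff by auto
  then have "definable_pred M (\<lambda>e. e i \<in> closure (insert b A))" for i
    by (simp only:) (intro definable_intros B)
  then show ?thesis
    unfolding definable2_def gap_ends_def by (intro allI definable_intros B)
qed

text \<open>As long as the ratios are not dense, a linear combination multiplies the exponent by
  3/2. The number \<open>n\<close> bounds the remaining steps: at \<open>n = 0\<close> the exponent
  has reached 2, which boundedness excludes.\<close>

lemma ratios_dense_exists:
  assumes "definable2 P" "timed_points P" "large s (point_set P)" "0 < s"
  shows "\<exists>P'. definable2 P' \<and> timed_points P' \<and> ratios_dense (point_set P')"
proof -
  have "\<exists>P'. definable2 P' \<and> timed_points P' \<and> ratios_dense (point_set P')"
    if "definable2 P" "timed_points P" "large s (point_set P)" "0 < s" "2 \<le> s * (3 / 2) ^ n" for n P s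
    using that
  proof (induction n arbitrary: P s)
    case 0
    then show ?case using large_bounded_exponent[of s "point_set P"] by (simp add: timed_points_def)
  next
    case (Suc n)
    show ?case
    proof (cases "ratios_dense (point_set P)")
      case False
      then obtain p q where "p < q" "\<And>a b c d. a \<in> point_set P \<Longrightarrow> b \<in> point_set P \<Longrightarrow> c \<in> point_set P \<Longrightarrow> d \<in> point_set P \<Longrightarrow>
          c \<noteq> d \<Longrightarrow> \<not> (p < (a - b) / (c - d) \<and> (a - b) / (c - d) < q)"
        unfolding ratios_dense_def by blast
      then obtain x where "large (3 / 2 * s) (point_set (linear_combinations x P))"
        using large_linear_image[OF Suc.prems(3,4)] unfolding point_set_linear_combinations by blast
      moreover have "2 \<le> (3 / 2 * s) * (3 / 2) ^ n" using Suc.prems(5) by (simp add: mult_ac)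
      ultimately show ?thesis
        using Suc.IH[of "linear_combinations x P" "3 / 2 * s"] Suc.prems
          definable2_linear_combinations timed_points_linear_combinations by simp
    qed (use Suc.prems in blast)
  qed
  moreover obtain n where "2 / s < (3 / 2) ^ n" using real_arch_pow[of "3 / 2" "2 / s"] by auto
  then have "2 \<le> s * (3 / 2) ^ n" using assms(4) by (simp add: divide_less_eq mult.commute)
  ultimately show ?thesis using assms by blast
qed

end

theorem mainTheorem1:
  fixes M :: "('f, 'p) rstruct"
  assumes "expands_real_field M"
  shows "definable1 M (\<int> :: real set) \<or>
         (\<forall>A. definable1 M A \<and> bounded A \<and> nowhere_dense A \<longrightarrow> M_null A)"
proof (rule disjCI)
  interpret real_field_expansion M using assms by unfold_locales
  assume "\<not> (\<forall>A. definable1 M A \<and> bounded A \<and> nowhere_dense A \<longrightarrow> M_null A)"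
  then obtain A where A: "definable1 M A" "bounded A" "nowhere_dense A" "\<not> M_null A" by blast
  obtain C where C: "\<And>a. a \<in> A \<Longrightarrow> \<bar>a\<bar> \<le> C" using A(2) unfolding bounded_iff by auto
  \<comment> \<open>Subtracting 1 places \<open>b\<close> strictly below \<open>A\<close>, as the
    density of the gap ends requires.\<close>
  define b where "b = - C - 1"
  have b: "b < a" if "a \<in> A" for a using C[OF that] by (simp add: b_def)
  obtain s where "0 < s" "large s (point_set (gap_ends (insert b A)))"
    using large_of_not_M_null[OF A(2,4) gap_ends_dense[OF A(3) b]] by blast
  then obtain P where "definable2 P" "timed_points P" "ratios_dense (point_set P)"
    using ratios_dense_exists[OF definable2_gap_ends[OF A(1)] timed_points_gap_ends] A(2) bounded_insert by metis
  then show "definable1 M \<int>"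
    using definable_Ints_of_timed_dense_points[OF timed_dense_points_unit_ratios definable2_unit_ratios] by blast
qed

end
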